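(* Let $d\ge 1$ be an integer and let $\{f_N\}_{N\in\mathbb{N}}$ be a sequence of functions $f_N:\mathbb{Z}_N^d\to\mathbb{C}$. Let $\alpha\in(0,d)$ and $1\le p<\frac{2d}{\alpha}$. Suppose that there exists a constant $C>0$, independent of $N$, such that $\|f_N\|_{L^p(\mathbb{Z}_N^d)}\le C$ for every $N\in\mathbb{N}$. Let $S_N:=\operatorname{supp}(\widehat{f_N})$ and assume that $|S_N|\approx N^\alpha$, i.e. there are constants $C_1,C_2>0$ independent of $N$ with $C_1N^\alpha\le|S_N|\le C_2N^\alpha$ for every $N$. Then $$\|f_N\|_{L^\infty(\mathbb{Z}_N^d)}\longrightarrow 0\qquad\text{as }N\to\infty.$$
   Context: $\mathbb{Z}_N^d$ is the $d$-fold product of the cyclic group $\mathbb{Z}_N=\mathbb{Z}/N\mathbb{Z}$; $\mathbb{N}$ is the set of positive integers. For $f:\mathbb{Z}_N^d\to\mathbb{C}$ the Fourier transform $\widehat f:\mathbb{Z}_N^d\to\mathbb{C}$ is $\widehat f(m)=N^{-d/2}\sum_{x\in\mathbb{Z}_N^d} f(x)e^{-2\pi i\, x\cdot m/N}$, where $x\cdot m=\sum_{j=1}^d x_jm_j$. Norms are with respect to counting measure: $\|f\|_{L^p(\mathbb{Z}_N^d)}=\left(\sum_{x\in\mathbb{Z}_N^d}|f(x)|^p\right)^{1/p}$ for $1\le p<\infty$ and $\|f\|_{L^\infty(\mathbb{Z}_N^d)}=\max_{x\in\mathbb{Z}_N^d}|f(x)|$. $\operatorname{supp}$ denotes the set of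 points where a function is nonzero. No compatibility between the functions $f_N$ for different $N$ is assumed. *)

theory Defs
  imports "HOL-Analysis.Analysis" "HOL-Number_Theory.Residues"
begin

text \<open>
  A point of \<open>(\<int>/N\<int>)^d\<close> is represented by its coordinates \<open>0, \<dots>, d - 1\<close>, each the
  canonical representative in \<open>{0..N - 1}\<close>, so \<open>torus N d\<close> has exactly \<open>N ^ d\<close> elements
  for \<open>N > 0\<close>.  A function on \<open>(\<int>/N\<int>)^d\<close> is a HOL function of type
  \<open>(nat \<Rightarrow> int) \<Rightarrow> complex\<close> of which only the values on \<open>torus N d\<close> are ever used.
\<close>

definition torus :: "nat \<Rightarrow> nat \<Rightarrow> (nat \<Rightarrow> int) set" where
  "torus N d = ({..<d} \<rightarrow>\<^sub>E carrier (residue_ring (int N)))"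

text \<open>
  The dot product is taken in \<open>\<int>\<close>; changing a coordinate by a multiple of \<open>N\<close> changes it by
  a multiple of \<open>N\<close>, which the exponential in \<open>dft\<close> does not see.
\<close>

definition dot :: "nat \<Rightarrow> (nat \<Rightarrow> int) \<Rightarrow> (nat \<Rightarrow> int) \<Rightarrow> int" where
  "dot d x m = (\<Sum>j<d. x j * m j)"

definition dft :: "nat \<Rightarrow> nat \<Rightarrow> ((nat \<Rightarrow> int) \<Rightarrow> complex) \<Rightarrow> (nat \<Rightarrow> int) \<Rightarrow> complex" where
  "dft N d f m = of_real (real N powr (- real d / 2)) *
     (\<Sum>x\<in>torus N d. f x * exp (- 2 * of_real pi * \<i> * of_int (dot d x m) / of_nat N))"

definition Lp_norm :: "nat \<Rightarrow> nat \<Rightarrow> real \<Rightarrow> ((nat \<Rightarrow> int) \<Rightarrow> complex) \<Rightarrow> real" where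
  "Lp_norm N d p f = (\<Sum>x\<in>torus N d. norm (f x) powr p) powr (1 / p)"

definition Linf_norm :: "nat \<Rightarrow> nat \<Rightarrow> ((nat \<Rightarrow> int) \<Rightarrow> complex) \<Rightarrow> real" where
  "Linf_norm N d f = Max ((\<lambda>x. norm (f x)) ` torus N d)"

definition supp :: "nat \<Rightarrow> nat \<Rightarrow> ((nat \<Rightarrow> int) \<Rightarrow> complex) \<Rightarrow> (nat \<Rightarrow> int) set" where
  "supp N d g = {m \<in> torus N d. g m \<noteq> 0}"

end

theory Submission
  imports Defs "HOL-Library.Real_Mod"
begin

text \<open>
  By Fourier inversion, Cauchy--Schwarz over the frequency support \<open>S\<close> and Plancherel,
  \<open>|f x|\<^sup>2 \<le> N\<^sup>-\<^sup>d |S| \<parallel>f\<parallel>\<^sub>2\<^sup>2\<close>.  The comparison of \<open>\<ell>\<^sup>2\<close> with \<open>\<ell>\<^sup>p\<close> on a set of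
  \<open>N\<^sup>d\<close> points costs a factor \<open>N powr (d max(0, 1 - 2/p))\<close>, so \<open>|f x|\<^sup>2\<close> is at most a constant
  times \<open>N\<close> to the power \<open>max (\<alpha> - d) (\<alpha> - 2d/p)\<close>, which is negative exactly because
  \<open>\<alpha> < d\<close> and \<open>p < 2d/\<alpha>\<close>.
\<close>

section \<open>Characters of the discrete torus and their orthogonality\<close>

definition character :: "nat \<Rightarrow> nat \<Rightarrow> (nat \<Rightarrow> int) \<Rightarrow> (nat \<Rightarrow> int) \<Rightarrow> complex" where
  "character N d x m = cis (2 * pi * of_int (dot d x m) / real N)"

lemma torus_eq: "torus N d = ({..<d} \<rightarrow>\<^sub>E {0..int N - 1})"
  by (simp add: torus_def residue_ring_def)

lemma finite_torus [simp]: "finite (torus N d)"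
  by (auto simp: torus_eq intro: finite_PiE)

lemma card_torus: "card (torus N d) = N ^ d"
  by (simp add: torus_eq card_PiE)

lemma torus_nonempty: "N \<ge> 1 \<Longrightarrow> torus N d \<noteq> {}"
  by (auto simp: torus_eq PiE_eq_empty_iff)

text \<open>With the kernel of the transform written as the conjugate of a \<open>cis\<close> of a
  real angle, norms and products of characters reduce to identities for \<open>cis\<close>.\<close>

lemma dft_eq_sum_character:
  "dft N d f m = of_real (real N powr (- real d / 2)) *
     (\<Sum>x\<in>torus N d. f x * cnj (character N d x m))"
proof -
  have "exp (- 2 * of_real pi * \<i> * of_int k / of_nat N) =
          cnj (cis (2 * pi * of_int k / real N))" for k :: int
    by (simp add: cis_cnj) (simp add: cis_conv_exp mult_ac)
  then show ?thesis
    by (simp only: dft_def character_def)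
qed

text \<open>This is a geometric sum whose ratio \<open>z\<close> is an \<open>N\<close>-th root of
  unity, and \<open>z\<close> equals 1 exactly when \<open>N\<close> divides
  \<open>k\<close>.\<close>

lemma sum_cis_residues:
  fixes k :: int
  assumes "N \<ge> 1"
  shows "(\<Sum>j\<in>{0..int N - 1}. cis (2 * pi * of_int (k * j) / real N)) =
           (if int N dvd k then of_nat N else 0)"
proof -
  define z where "z = cis (2 * pi * of_int k / real N)"
  have zpow: "z ^ n = cis (2 * pi * of_int (k * int n) / real N)" for n
    unfolding z_def Complex.DeMoivre by (rule arg_cong[where f = cis]) simp
  have "(\<Sum>j\<in>{0..int N - 1}. cis (2 * pi * of_int (k * j) / real N)) = (\<Sum>n<N. z ^ n)"
    by (rule sum.reindex_bij_witness[of _ int nat]) (auto simp: zpow)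
  also have "\<dots> = (if int N dvd k then of_nat N else 0)"
  proof (cases "int N dvd k")
    case True
    then obtain l where "k = int N * l" ..
    with assms have "2 * pi * of_int k / real N = 2 * pi * of_int l"
      by simp
    then have "z = 1"
      unfolding z_def by (simp only: cis_multiple_2pi Ints_of_int)
    with True show ?thesis
      by simp
  next
    case False
    have "z \<noteq> 1"
    proof
      assume "z = 1"
      then obtain n :: int where "2 * pi * of_int k / real N = of_int n * (2 * pi)"
        by (auto simp: z_def cis_eq_1_iff)
      with assms have "real_of_int k = of_int (n * int N)"
        by (simp add: field_simps)
      then have "k = n * int N"
        by (simp only: of_int_eq_iff)
      with False show False
        by simp
    qed
    moreover have "z ^ N = 1"
      using assms cis_multiple_2pi[OF Ints_of_int[of k]] by (simp add: zpow mult.assoc)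
    ultimately show ?thesis
      using False by (simp add: geometric_sum)
  qed
  finally show ?thesis .
qed

text \<open>Splitting into one factor per coordinate of \<open>m\<close> lets a sum over the whole
  torus factor into one-dimensional sums.\<close>

lemma character_mult_cnj:
  "character N d x m * cnj (character N d y m) =
     (\<Prod>j<d. cis (2 * pi * of_int ((x j - y j) * m j) / real N))"
proof -
  have cis_sum: "cis (\<Sum>j\<in>A. g j) = (\<Prod>j\<in>A. cis (g j))" if "finite A" for g and A :: "nat set"
    using that by (induction A) (auto simp: cis_mult[symmetric])
  have "2 * pi * of_int (dot d x m) / real N + - (2 * pi * of_int (dot d y m) / real N) =
          2 * pi * (\<Sum>j<d. of_int ((x j - y j) * m j)) / real N"
    by (simp add: dot_def sum_subtractf left_diff_distrib right_diff_distrib diff_divide_distrib)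
  also have "\<dots> = (\<Sum>j<d. 2 * pi * of_int ((x j - y j) * m j) / real N)"
    by (simp only: sum_distrib_left sum_divide_distrib)
  finally show ?thesis
    by (simp only: character_def cis_cnj cis_mult cis_sum finite_lessThan)
qed

text \<open>By distributivity the sum over \<open>m\<close> is a product of geometric sums, one per
  coordinate. The \<open>j\<close>-th vanishes unless \<open>N\<close> divides
  \<open>x j - y j\<close>, and for representatives in \<open>{0..N - 1}\<close> that divisibility
  means equality.\<close>

lemma character_orthogonality:
  assumes "N \<ge> 1" and x: "x \<in> torus N d" and y: "y \<in> torus N d"
  shows "(\<Sum>m\<in>torus N d. character N d x m * cnj (character N d y m)) =
           (if x = y then of_nat N ^ d else 0)"
proof -
  have dvd_iff: "int N dvd x j - y j \<longleftrightarrow> x j = y j" if "j < d" for j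
  proof
    assume "int N dvd x j - y j"
    then have "x j mod int N = y j mod int N"
      by (simp only: mod_eq_dvd_iff)
    moreover have "x j \<in> {0..int N - 1}" "y j \<in> {0..int N - 1}"
      using x[unfolded torus_eq] y[unfolded torus_eq] that by (blast intro: PiE_mem)+
    ultimately show "x j = y j"
      by (simp add: mod_pos_pos_trivial)
  qed simp
  have "(\<Sum>m\<in>torus N d. character N d x m * cnj (character N d y m)) =
          (\<Prod>j<d. \<Sum>k\<in>{0..int N - 1}. cis (2 * pi * of_int ((x j - y j) * k) / real N))"
    by (subst prod_sum_PiE) (simp_all add: character_mult_cnj torus_eq)
  also have "\<dots> = (\<Prod>j<d. if x j = y j then of_nat N else 0)"
    by (rule prod.cong) (auto simp: sum_cis_residues[OF assms(1)] dvd_iff simp del: of_int_mult of_int_diff)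
  also have "\<dots> = (if x = y then of_nat N ^ d else 0)"
  proof (cases "x = y")
    case False
    have "x = y" if "\<And>j. j < d \<Longrightarrow> x j = y j"
      using x[unfolded torus_eq] y[unfolded torus_eq] by (rule PiE_ext) (simp add: that)
    with False obtain j where "j < d" "x j \<noteq> y j"
      by blast
    with False show ?thesis
      by (auto intro!: prod_zero)
  qed simp
  finally show ?thesis .
qed

section \<open>Fourier inversion and the Plancherel identity\<close>

lemma dft_inversion:
  assumes N: "N \<ge> 1" and x: "x \<in> torus N d"
  shows "(\<Sum>m\<in>torus N d. dft N d f m * character N d x m) = of_real (real N powr (real d / 2)) * f x"
proof -
  define c :: complex where "c = of_real (real N powr (- real d / 2))"
  have "(\<Sum>m\<in>torus N d. dft N d f m * character N d x m) =
          (\<Sum>m\<in>torus N d. \<Sum>y\<in>torus N d.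
             c * f y * (character N d x m * cnj (character N d y m)))"
    unfolding dft_eq_sum_character c_def[symmetric] sum_distrib_left sum_distrib_right
    by (intro sum.cong refl) (simp only: mult_ac)
  \<comment> \<open>After the exchange of sums, orthogonality kills every term except
    \<open>y = x\<close>, which carries the factor \<open>c * N ^ d\<close>.\<close>
  also have "\<dots> = (\<Sum>y\<in>torus N d. c * f y *
                     (\<Sum>m\<in>torus N d. character N d x m * cnj (character N d y m)))"
    by (subst sum.swap) (simp add: sum_distrib_left)
  also have "\<dots> = (\<Sum>y\<in>torus N d. if x = y then c * f y * of_nat N ^ d else 0)"
    by (rule sum.cong) (use N x in \<open>simp_all add: character_orthogonality\<close>)
  also have "\<dots> = c * of_nat N ^ d * f x"
    using x by (simp add: mult_ac)
  also have "c * of_nat N ^ d = of_real (real N powr (real d / 2))"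
  proof -
    have "real N ^ d = real N powr (real d / 2) * real N powr (real d / 2)"
      using N by (simp add: powr_add[symmetric] powr_realpow)
    then have "real N powr (- real d / 2) * real N ^ d = real N powr (real d / 2)"
      using N by (simp add: powr_minus)
    from arg_cong[OF this, of complex_of_real] show ?thesis
      by (simp add: c_def)
  qed
  finally show ?thesis .
qed

text \<open>Only one factor of \<open>dft N d f m * cnj (dft N d f m)\<close> is expanded. After the
  exchange of sums, the inner sum over \<open>m\<close> is the conjugate of the inversion sum at
  \<open>x\<close>, so inversion finishes the computation.\<close>

lemma plancherel:
  assumes N: "N \<ge> 1"
  shows "(\<Sum>m\<in>torus N d. (norm (dft N d f m))\<^sup>2) = (\<Sum>x\<in>torus N d. (norm (f x))\<^sup>2)"
proof -
  define c where "c = real N powr (- real d / 2)"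
  have c: "c * real N powr (real d / 2) = 1"
    using N by (simp add: c_def powr_add[symmetric])
  \<comment> \<open>Here \<open>w\<close> stands for the conjugate transform, which is kept
    unexpanded.\<close>
  have expand: "dft N d f m * w = (\<Sum>x\<in>torus N d. of_real c * f x * (w * cnj (character N d x m)))" for m w
    unfolding dft_eq_sum_character c_def[symmetric] sum_distrib_left sum_distrib_right
    by (intro sum.cong refl) (simp only: mult_ac)
  have "(\<Sum>m\<in>torus N d. dft N d f m * cnj (dft N d f m)) =
          (\<Sum>m\<in>torus N d. \<Sum>x\<in>torus N d.
             of_real c * f x * cnj (dft N d f m * character N d x m))"
    unfolding complex_cnj_mult by (intro sum.cong refl expand)
  also have "\<dots> = (\<Sum>x\<in>torus N d. of_real c * f x *
                     cnj (\<Sum>m\<in>torus N d. dft N d f m * character N d x m))"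
    by (subst sum.swap) (simp only: sum_distrib_left cnj_sum)
  also have "\<dots> = (\<Sum>x\<in>torus N d. of_real (c * real N powr (real d / 2)) * (f x * cnj (f x)))"
  proof (rule sum.cong)
    fix x assume "x \<in> torus N d"
    from dft_inversion[OF N this]
    show "of_real c * f x * cnj (\<Sum>m\<in>torus N d. dft N d f m * character N d x m) =
            of_real (c * real N powr (real d / 2)) * (f x * cnj (f x))"
      by (simp only: complex_cnj_mult complex_cnj_complex_of_real of_real_mult mult_ac)
  qed simp
  finally have "(\<Sum>m\<in>torus N d. dft N d f m * cnj (dft N d f m)) =
                  (\<Sum>x\<in>torus N d. f x * cnj (f x))"
    by (simp add: c)
  then have "complex_of_real (\<Sum>m\<in>torus N d. (norm (dft N d f m))\<^sup>2) =
               of_real (\<Sum>x\<in>torus N d. (norm (f x))\<^sup>2)"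
    by (simp only: of_real_sum complex_norm_square)
  then show ?thesis
    by (simp only: of_real_eq_iff)
qed

section \<open>Pointwise bound through the size of the frequency support\<close>

lemma norm_squared_le_card_supp:
  assumes N: "N \<ge> 1" and x: "x \<in> torus N d"
  shows "(norm (f x))\<^sup>2 \<le> real N powr (- real d) * real (card (supp N d (dft N d f))) *
           (\<Sum>y\<in>torus N d. (norm (f y))\<^sup>2)"
proof -
  define S where "S = supp N d (dft N d f)"
  have S: "S \<subseteq> torus N d"
    by (auto simp: S_def supp_def)
  have "real N powr (real d / 2) * norm (f x) = norm (\<Sum>m\<in>torus N d. dft N d f m * character N d x m)"
    using N x by (simp add: dft_inversion norm_mult)
  \<comment> \<open>Frequencies outside \<open>S\<close> contribute nothing to the inversion sum;
    hence \<open>card S\<close> instead of \<open>N ^ d\<close> in the bound.\<close>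
  also have "\<dots> = norm (\<Sum>m\<in>S. dft N d f m * character N d x m)"
    by (intro arg_cong[where f = norm] sum.mono_neutral_right) (use S in \<open>auto simp: S_def supp_def\<close>)
  also have "\<dots> \<le> (\<Sum>m\<in>S. norm (dft N d f m))"
    by (rule sum_norm_le) (simp add: norm_mult character_def)
  finally have "(real N powr (real d / 2) * norm (f x))\<^sup>2 \<le> (\<Sum>m\<in>S. norm (dft N d f m))\<^sup>2"
    by (intro power_mono) auto
  \<comment> \<open>Cauchy-Schwarz against the constant function 1 on \<open>S\<close>.\<close>
  also have "\<dots> \<le> real (card S) * (\<Sum>m\<in>S. (norm (dft N d f m))\<^sup>2)"
    using Cauchy_Schwarz_ineq_sum[of "\<lambda>_. 1" "\<lambda>m. norm (dft N d f m)" S] by simp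
  also have "\<dots> \<le> real (card S) * (\<Sum>m\<in>torus N d. (norm (dft N d f m))\<^sup>2)"
    using S by (intro mult_left_mono sum_mono2) auto
  also have "(\<Sum>m\<in>torus N d. (norm (dft N d f m))\<^sup>2) = (\<Sum>y\<in>torus N d. (norm (f y))\<^sup>2)"
    using N by (rule plancherel)
  also have "(real N powr (real d / 2) * norm (f x))\<^sup>2 = real N powr (real d) * (norm (f x))\<^sup>2"
    by (simp add: power_mult_distrib power2_eq_square powr_add[symmetric])
  finally have "real N powr (- real d) * (real N powr real d * (norm (f x))\<^sup>2) \<le>
      real N powr (- real d) * (real (card S) * (\<Sum>y\<in>torus N d. (norm (f y))\<^sup>2))"
    by (rule mult_left_mono) simp
  moreover have "real N powr (- real d) * (real N powr real d * (norm (f x))\<^sup>2) = (norm (f x))\<^sup>2"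
    using N by (simp add: mult.assoc[symmetric] powr_add[symmetric])
  ultimately show ?thesis
    by (simp add: S_def mult.assoc)
qed

section \<open>Comparison of square sums with p-norms\<close>

lemma sum_power2_le_sum_powr:
  fixes g :: "'a \<Rightarrow> real"
  assumes fin: "finite A" and g: "\<And>x. x \<in> A \<Longrightarrow> g x \<ge> 0" and p: "1 \<le> p" "p \<le> 2"
  shows "(\<Sum>x\<in>A. (g x)\<^sup>2) \<le> ((\<Sum>x\<in>A. g x powr p) powr (1 / p))\<^sup>2"
proof -
  define s where "s = (\<Sum>x\<in>A. g x powr p)"
  define a where "a = s powr (1 / p)"
  have s0: "s \<ge> 0"
    unfolding s_def by (rule sum_nonneg) simp
  have ap: "a powr p = s"
    using p s0 by (simp add: a_def powr_powr)
  have "g x \<le> a" if "x \<in> A" for x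
  proof -
    have "g x powr p \<le> s"
      unfolding s_def by (rule member_le_sum) (use that fin in auto)
    then have "(g x powr p) powr (1 / p) \<le> a"
      unfolding a_def using p by (intro powr_mono2) auto
    then show ?thesis
      using g[OF that] p by (simp add: powr_powr)
  qed
  \<comment> \<open>Split the square as \<open>g x powr p * g x powr (2 - p)\<close>. Since
    \<open>2 - p\<close> is nonnegative, the second factor grows when \<open>g x\<close> is replaced
    by the p-norm \<open>a\<close>, while the first sums to \<open>a powr p\<close>.\<close>
  then have "(g x)\<^sup>2 \<le> g x powr p * a powr (2 - p)" if "x \<in> A" for x
  proof (cases "g x = 0")
    case False
    then have "(g x)\<^sup>2 = g x powr p * g x powr (2 - p)"
      using g[OF that] by (simp add: powr_add[symmetric])
    also have "\<dots> \<le> g x powr p * a powr (2 - p)"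
      using p that g \<open>x \<in> A \<Longrightarrow> g x \<le> a\<close> by (intro mult_left_mono powr_mono2) auto
    finally show ?thesis .
  qed simp
  then have "(\<Sum>x\<in>A. (g x)\<^sup>2) \<le> (\<Sum>x\<in>A. g x powr p * a powr (2 - p))"
    by (rule sum_mono)
  also have "\<dots> = a powr p * a powr (2 - p)"
    by (simp add: ap s_def sum_distrib_right)
  also have "\<dots> \<le> a\<^sup>2"
    by (cases "a = 0") (auto simp: powr_add[symmetric] a_def)
  finally show ?thesis
    by (simp add: a_def s_def)
qed

text \<open>This is Hoelder's inequality for the squares of \<open>g\<close> against the constant 1,
  obtained from Young's inequality termwise after a rescaling that gives the p-th powers mean
  1.\<close>

lemma sum_power2_le_card_powr:
  fixes g :: "'a \<Rightarrow> real"
  assumes fin: "finite A" and g: "\<And>x. x \<in> A \<Longrightarrow> g x \<ge> 0" and p: "p \<ge> 2"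
  shows "(\<Sum>x\<in>A. (g x)\<^sup>2) \<le>
           real (card A) powr (1 - 2 / p) * ((\<Sum>x\<in>A. g x powr p) powr (1 / p))\<^sup>2"
proof -
  define s where "s = (\<Sum>x\<in>A. g x powr p)"
  define n where "n = real (card A)"
  have s0: "s \<ge> 0"
    unfolding s_def by (rule sum_nonneg) simp
  show ?thesis
  \<comment> \<open>The rescaling by \<open>n / s\<close> needs \<open>s\<close> positive; for
    \<open>s = 0\<close> every value of \<open>g\<close> on \<open>A\<close> vanishes.\<close>
  proof (cases "s = 0")
    case True
    then have "\<forall>x\<in>A. g x powr p = 0"
      using fin by (simp add: s_def sum_nonneg_eq_0_iff)
    then show ?thesis
      using True by (simp add: s_def)
  next
    case False
    then have s: "s > 0" and "A \<noteq> {}"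
      using s0 by (auto simp: s_def)
    then have n: "n > 0"
      using fin by (simp add: n_def card_gt_0_iff)
    \<comment> \<open>Young's inequality with weights \<open>2 / p\<close> and
      \<open>1 - 2 / p\<close> for the numbers \<open>g x powr p * (n / s)\<close> and 1. The
      rescaled powers add up to \<open>n\<close>, so the right-hand sides add up to \<open>n\<close>
      as well.\<close>
    have "(n / s) powr (2 / p) * (g x)\<^sup>2 \<le> 2 / p * (g x powr p * (n / s)) + (1 - 2 / p)"
      if "x \<in> A" for x
    proof (cases "g x = 0")
      case False
      have "(g x powr p * (n / s)) powr (2 / p) = (n / s) powr (2 / p) * (g x)\<^sup>2"
        using g[OF that] p n s by (subst powr_mult) (simp_all add: powr_powr mult.commute)
      moreover have "(g x powr p * (n / s)) powr (2 / p) * 1 powr (1 - 2 / p) \<le>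
          2 / p * (g x powr p * (n / s)) + (1 - 2 / p) * 1"
        using p n s False by (intro Youngs_inequality_0) auto
      ultimately show ?thesis
        by simp
    qed (use p in simp)
    then have "(\<Sum>x\<in>A. (n / s) powr (2 / p) * (g x)\<^sup>2) \<le>
                 (\<Sum>x\<in>A. 2 / p * (g x powr p * (n / s)) + (1 - 2 / p))"
      by (rule sum_mono)
    also have "\<dots> = 2 / p * (s * (n / s)) + n * (1 - 2 / p)"
      by (simp only: sum.distrib sum_constant s_def n_def
          sum_distrib_left[symmetric] sum_distrib_right[symmetric])
    also have "\<dots> = n"
      using s p by (simp add: field_simps)
    finally have "(n / s) powr (2 / p) * (\<Sum>x\<in>A. (g x)\<^sup>2) \<le> n"
      by (simp add: sum_distrib_left)
    then have "(\<Sum>x\<in>A. (g x)\<^sup>2) \<le> n / (n / s) powr (2 / p)"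
      using n s by (simp add: field_simps)
    also have "\<dots> = n powr (1 - 2 / p) * (s powr (1 / p))\<^sup>2"
      using n s by (simp add: powr_divide powr_diff power2_eq_square powr_add[symmetric])
    finally show ?thesis
      by (simp add: n_def s_def)
  qed
qed

text \<open>The maximum joins two regimes: for \<open>p \<le> 2\<close> the comparison is lossless
  and \<open>1 - 2 / p\<close> is nonpositive, while for larger \<open>p\<close> the Hoelder factor
  is the cardinality \<open>N ^ d\<close> to the power \<open>1 - 2 / p\<close>.\<close>

lemma sum_power2_le_Lp_norm:
  assumes N: "N \<ge> 1" and p: "p \<ge> 1"
  shows "(\<Sum>x\<in>torus N d. (norm (f x))\<^sup>2) \<le>
           real N powr (real d * max 0 (1 - 2 / p)) * (Lp_norm N d p f)\<^sup>2"
proof (cases "p \<le> 2")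
  case True
  then have "max 0 (1 - 2 / p) = 0"
    using p by (simp add: field_simps)
  with True N p sum_power2_le_sum_powr[of "torus N d" "\<lambda>x. norm (f x)" p] show ?thesis
    by (simp add: Lp_norm_def)
next
  case False
  then have "max 0 (1 - 2 / p) = 1 - 2 / p"
    by (simp add: field_simps)
  with False N p sum_power2_le_card_powr[of "torus N d" "\<lambda>x. norm (f x)" p] show ?thesis
    using powr_powr[of "real N" "real d" "1 - 2 / p"]
    by (simp add: Lp_norm_def card_torus powr_realpow)
qed

section \<open>Decay of the supremum norm\<close>

lemma Linf_norm_attained:
  assumes "N \<ge> 1"
  obtains x where "x \<in> torus N d" "Linf_norm N d f = norm (f x)"
proof -
  have "Linf_norm N d f \<in> (\<lambda>x. norm (f x)) ` torus N d"
    unfolding Linf_norm_def using torus_nonempty[OF assms] by (intro Max_in) auto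
  with that show thesis
    by blast
qed

theorem corollary4:
  fixes d :: nat and f :: "nat \<Rightarrow> (nat \<Rightarrow> int) \<Rightarrow> complex" and \<alpha> p :: real
  assumes "d \<ge> 1"
    and "0 < \<alpha>" and "\<alpha> < real d"
    and "1 \<le> p" and "p < 2 * real d / \<alpha>"
    and "\<exists>C>0. \<forall>N\<ge>1. Lp_norm N d p (f N) \<le> C"
    and "\<exists>C\<^sub>1>0. \<exists>C\<^sub>2>0. \<forall>N\<ge>1.
           C\<^sub>1 * real N powr \<alpha> \<le> real (card (supp N d (dft N d (f N)))) \<and>
           real (card (supp N d (dft N d (f N)))) \<le> C\<^sub>2 * real N powr \<alpha>"
  shows "(\<lambda>N. Linf_norm N d (f N)) \<longlonglongrightarrow> 0"
proof -
  obtain C where C: "Lp_norm N d p (f N) \<le> C" if "N \<ge> 1" for N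
    using assms(6) by blast
  obtain D where D: "real (card (supp N d (dft N d (f N)))) \<le> D * real N powr \<alpha>" if "N \<ge> 1" for N
    using assms(7) by blast
  \<comment> \<open>The three summands come from the support size, the factor
    \<open>N powr (- d)\<close> of the pointwise bound, and the norm comparison. The total is
    \<open>\<alpha> - d\<close> for \<open>p \<le> 2\<close> and \<open>\<alpha> - 2 * d / p\<close>
    otherwise.\<close>
  define e where "e = \<alpha> - real d + real d * max 0 (1 - 2 / p)"
  have e: "e < 0"
    using assms(2-5) by (auto simp: e_def max_def field_simps)
  have bound: "(Linf_norm N d (f N))\<^sup>2 \<le> D * C\<^sup>2 * real N powr e" if N: "N \<ge> 1" for N
  proof -
    obtain x where x: "x \<in> torus N d" "Linf_norm N d (f N) = norm (f N x)"
      using Linf_norm_attained[OF N] .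
    have "(norm (f N x))\<^sup>2 \<le> real N powr (- real d) * real (card (supp N d (dft N d (f N)))) *
            (\<Sum>y\<in>torus N d. (norm (f N y))\<^sup>2)"
      using N x(1) by (rule norm_squared_le_card_supp)
    also have "\<dots> \<le> real N powr (- real d) * (D * real N powr \<alpha>) *
            (real N powr (real d * max 0 (1 - 2 / p)) * C\<^sup>2)"
    proof (intro mult_mono mult_left_mono)
      have "(\<Sum>y\<in>torus N d. (norm (f N y))\<^sup>2) \<le>
              real N powr (real d * max 0 (1 - 2 / p)) * (Lp_norm N d p (f N))\<^sup>2"
        using N assms(4) by (rule sum_power2_le_Lp_norm)
      also have "\<dots> \<le> real N powr (real d * max 0 (1 - 2 / p)) * C\<^sup>2"
        using C[OF N] by (intro mult_left_mono power_mono) (auto simp: Lp_norm_def)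
      finally show "(\<Sum>y\<in>torus N d. (norm (f N y))\<^sup>2) \<le>
                      real N powr (real d * max 0 (1 - 2 / p)) * C\<^sup>2" .
      \<comment> \<open>Monotonicity of the product needs this factor nonnegative; it is, because it
        bounds a cardinality.\<close>
      have "0 \<le> D * real N powr \<alpha>"
        using D[OF N] by linarith
      then show "0 \<le> real N powr (- real d) * (D * real N powr \<alpha>)"
        by simp
    qed (use D[OF N] in \<open>auto intro: sum_nonneg\<close>)
    also have "\<dots> = D * C\<^sup>2 *
        (real N powr (- real d) * real N powr \<alpha> * real N powr (real d * max 0 (1 - 2 / p)))"
      by (simp only: mult_ac)
    also have "real N powr (- real d) * real N powr \<alpha> * real N powr (real d * max 0 (1 - 2 / p)) =
        real N powr e"
      by (simp add: powr_add[symmetric] e_def algebra_simps)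
    finally show ?thesis
      by (simp add: x(2))
  qed
  have "(\<lambda>N. real N powr e) \<longlonglongrightarrow> 0"
    using e by (intro tendsto_neg_powr filterlim_real_sequentially)
  then have "(\<lambda>N. D * C\<^sup>2 * real N powr e) \<longlonglongrightarrow> 0"
    by (rule tendsto_mult_right_zero)
  \<comment> \<open>Squeeze between 0 and the bound. At \<open>N = 0\<close> the torus is empty and
    the maximum has no meaning, so the inequality is used from \<open>N = 1\<close> on.\<close>
  then have "(\<lambda>N. (Linf_norm N d (f N))\<^sup>2) \<longlonglongrightarrow> 0"
    by (rule tendsto_sandwich[OF _ _ tendsto_const, rotated 2])
      (auto intro!: eventually_sequentiallyI[of 1] bound)
  then show ?thesis
    by simp
qed

end
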